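(* Let $T\in\mathbb{N}$ and let $(1,r_1,r_2,\ldots,r_{2T-2})$ be a vector of real numbers; put $r_0=1$. For $l=1,\ldots,T$ let $C^l\in\mathbb{R}^{l\times l}$ be the matrix with entries $$C^l_{ij}=\sum_{k=0}^{l-\max\{i,j\}} r_{|i-j|+2k},\qquad i,j=1,\ldots,l .$$ Then $(1,r_1,r_2,\ldots,r_{2T-2})$ is a response vector for the discrete dynamical system (defined in the context) with some real potential $(b_1,\ldots,b_{T-1})$ if and only if the matrix $C^T$ is positive definite and $\det C^l=1$ for all $l=1,\ldots,T$.
   Context: $\mathbb{N}=\{1,2,\ldots\}$, $\mathbb{N}_0=\mathbb{N}\cup\{0\}$. For a real sequence (potential) $(b_1,b_2,\ldots)$ and a real control sequence $f=(f_0,f_1,\ldots)$, let $u^f_{n,t}$ be the solution of the dynamical system with discrete time $$u_{n,t+1}+u_{n,t-1}-u_{n+1,t}-u_{n-1,t}+b_nu_{n,t}=0\quad (n\in\mathbb{N},\ t\in\mathbb{N}_0),$$ $$u_{n,-1}=u_{n,0}=0\ (n\in\mathbb{N}),\qquad u_{0,t}=f_t\ (t\in\mathbb{N}_0).$$ The response operator sends $f$ to $(u^f_{1,t})_{t\ge 1}$, and the response vector $(r_0,r_1,r_2,\ldots)$ is its convolution kernel: it is the sequence (with $r_0=1$) such that for every control $f$ $$u^f_{1,t}=\sum_{s=0}^{t-1} r_s f_{t-1-s},\qquad t\ge 1;$$ equivalently $r_s=u^{\delta}_{1,s+1}$ for the control $\delta=(1,0,0,\ldots)$. The components $r_0,\ldots,r_{2T-2}$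 depend only on $b_1,\ldots,b_{T-1}$. A vector $(1,r_1,\ldots,r_{2T-2})$ is called a response vector for the system with potential $(b_1,\ldots,b_{T-1})$ if it coincides with the first $2T-1$ components of the response vector of the system with that potential. *)

theory Defs
  imports Complex_Main "Jordan_Normal_Form.Determinant"
begin

text \<open>
  The potential \<open>b\<close> is indexed by \<open>n \<ge> 1\<close>, the value \<open>b 0\<close> is never used. A state \<open>u n t\<close> is only
  constrained for \<open>n \<ge> 0\<close>, \<open>t \<ge> -1\<close>, except that \<open>u 0 (-1)\<close> is left free, since it
  does not enter the system.
\<close>

definition dyn_solution ::
    "(nat \<Rightarrow> real) \<Rightarrow> (nat \<Rightarrow> real) \<Rightarrow> (nat \<Rightarrow> int \<Rightarrow> real) \<Rightarrow> bool" where
  "dyn_solution b f u \<longleftrightarrow>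
     (\<forall>n\<ge>1. \<forall>t\<ge>0. u n (t + 1) + u n (t - 1) - u (n + 1) t - u (n - 1) t + b n * u n t = 0) \<and>
     (\<forall>n\<ge>1. u n (-1) = 0 \<and> u n 0 = 0) \<and>
     (\<forall>t. u 0 (int t) = f t)"

definition response_kernel :: "(nat \<Rightarrow> real) \<Rightarrow> (nat \<Rightarrow> real) \<Rightarrow> bool" where
  "response_kernel b r \<longleftrightarrow>
     (\<forall>f u. dyn_solution b f u \<longrightarrow>
        (\<forall>t\<ge>1. u 1 (int t) = (\<Sum>s=0..t-1. r s * f (t - 1 - s))))"

definition response_vector :: "(nat \<Rightarrow> real) \<Rightarrow> nat \<Rightarrow> real" where
  "response_vector b = (THE r. response_kernel b r)"

text \<open>
  Here \<open>p\<close> is the finite potential \<open>(b 1, \<dots>, b (T-1))\<close>, with \<open>b n\<close> stored at index \<open>n - 1\<close>, and \<open>r\<close> is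
  \<open>(r 0, \<dots>, r (2T-2))\<close>. The infinite continuation of \<open>p\<close> is irrelevant, see
  \<open>response_vector_local\<close> below.
\<close>

definition is_response_vector_for :: "nat \<Rightarrow> real vec \<Rightarrow> real vec \<Rightarrow> bool" where
  "is_response_vector_for T p r \<longleftrightarrow>
     dim_vec p = T - 1 \<and> dim_vec r = 2 * T - 1 \<and>
     (\<forall>b. (\<forall>n\<in>{1..T-1}. b n = p $ (n - 1)) \<longrightarrow>
          (\<forall>s<2 * T - 1. r $ s = response_vector b s))"

text \<open>Matrix indices \<open>i\<close>, \<open>j\<close> start at \<open>0\<close>, hence the successors under \<open>max\<close>.\<close>

definition C_mat :: "real vec \<Rightarrow> nat \<Rightarrow> real mat" where
  "C_mat r l = mat l l (\<lambda>(i, j).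
     \<Sum>k=0..l - max (i + 1) (j + 1). r $ (nat \<bar>int i - int j\<bar> + 2 * k))"

definition positive_definite :: "real mat \<Rightarrow> bool" where
  "positive_definite A \<longleftrightarrow>
     square_mat A \<and> transpose_mat A = A \<and>
     (\<forall>v\<in>carrier_vec (dim_row A). v \<noteq> 0\<^sub>v (dim_row A) \<longrightarrow> v \<bullet> (A *\<^sub>v v) > 0)"

subsection \<open>Well-definedness\<close>

fun sol :: "(nat \<Rightarrow> real) \<Rightarrow> (nat \<Rightarrow> real) \<Rightarrow> nat \<Rightarrow> nat \<Rightarrow> real" where
  "sol b f 0 n = (if n = 0 then f 0 else 0)"
| "sol b f (Suc 0) n =
     (if n = 0 then f 1 else sol b f 0 (n + 1) + sol b f 0 (n - 1) - b n * sol b f 0 n)"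
| "sol b f (Suc (Suc t)) n =
     (if n = 0 then f (Suc (Suc t))
      else sol b f (Suc t) (n + 1) + sol b f (Suc t) (n - 1) - sol b f t n - b n * sol b f (Suc t) n)"

lemma sol_boundary: "sol b f t 0 = f t"
  by (cases "(b, f, t, 0::nat)" rule: sol.cases) auto

lemma dyn_solution_exists:
  "dyn_solution b f (\<lambda>n t. if t = -1 then 0 else sol b f (nat t) n)"
proof -
  have "sol b f (nat (t + 1)) n + (if t - 1 = -1 then 0 else sol b f (nat (t - 1)) n)
        - sol b f (nat t) (n + 1) - sol b f (nat t) (n - 1) + b n * sol b f (nat t) n = 0"
    if n: "n \<ge> 1" and t: "t \<ge> 0" for n :: nat and t :: int
  proof (cases "nat t")
    case 0
    then have "t = 0" using t by simp
    then show ?thesis using n by simp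
  next
    case (Suc k)
    then have "t = int k + 1" using t by linarith
    then have "nat (t + 1) = Suc (Suc k)" "nat t = Suc k" "nat (t - 1) = k" "t - 1 \<noteq> -1"
      by auto
    then show ?thesis using n by simp
  qed
  then show ?thesis by (auto simp: dyn_solution_def sol_boundary)
qed

lemma dyn_solution_unique:
  assumes "dyn_solution b f u"
  shows "u n (int t) = sol b f t n"
  using assms
proof (induction b f t n rule: sol.induct)
  case (1 b f n)
  have "u 0 (int 0) = f 0" using 1 unfolding dyn_solution_def by blast
  then show ?case using 1 by (auto simp: dyn_solution_def)
next
  case (2 b f n)
  show ?case
  proof (cases "n = 0")
    case True
    have "u 0 (int 1) = f 1" using "2.prems" unfolding dyn_solution_def by blast
    then show ?thesis using True by simp
  next
    case False
    have "u n (0 + 1) + u n (0 - 1) - u (n + 1) 0 - u (n - 1) 0 + b n * u n 0 = 0"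
      using "2.prems" False unfolding dyn_solution_def
      by (metis One_nat_def Suc_leI neq0_conv order_refl)
    moreover have "u n (0 - 1) = 0" using "2.prems" False unfolding dyn_solution_def by simp
    moreover have "u m 0 = sol b f 0 m" for m
      using "2.prems" unfolding dyn_solution_def
      by (metis One_nat_def Suc_leI neq0_conv of_nat_0 sol.simps(1))
    ultimately show ?thesis using False by simp
  qed
next
  case (3 b f t n)
  show ?case
  proof (cases "n = 0")
    case True
    have "u 0 (int (Suc (Suc t))) = f (Suc (Suc t))"
      using "3.prems" unfolding dyn_solution_def by blast
    then show ?thesis using True by (simp del: of_nat_Suc)
  next
    case False
    have "u n (int (Suc t) + 1) + u n (int (Suc t) - 1) - u (n + 1) (int (Suc t))
          - u (n - 1) (int (Suc t)) + b n * u n (int (Suc t)) = 0"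
      using "3.prems" False unfolding dyn_solution_def
      by (metis One_nat_def Suc_leI neq0_conv of_nat_0_le_iff)
    moreover have "int (Suc t) + 1 = int (Suc (Suc t))" "int (Suc t) - 1 = int t" by auto
    ultimately show ?thesis using False 3 by simp
  qed
qed

definition delta :: "nat \<Rightarrow> real" where
  "delta t = (if t = 0 then 1 else 0)"

lemma sol_convolution: "sol b f t n = (\<Sum>s\<le>t. sol b delta s n * f (t - s))"
proof (induction b f t n rule: sol.induct)
  case (1 b f n)
  then show ?case by (simp add: delta_def)
next
  case (2 b f n)
  then show ?case by (auto simp: delta_def)
next
  case (3 b f t n)
  show ?case
  proof (cases "n = 0")
    case True
    have "(\<Sum>s\<le>Suc (Suc t). delta s * f (Suc (Suc t) - s)) = (\<Sum>s\<in>{0}. delta s * f (Suc (Suc t) - s))"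
      by (rule sum.mono_neutral_right) (auto simp: delta_def)
    then show ?thesis using True by (simp add: sol_boundary delta_def del: sum.atMost_Suc sol.simps)
  next
    case False
    let ?g = "\<lambda>s n. sol b delta s n"
    have g: "?g (Suc s) n = ?g s (n + 1) + ?g s (n - 1) - (if s = 0 then 0 else ?g (s - 1) n) - b n * ?g s n" for s
      using False by (cases s) auto
    have z: "(\<Sum>s\<le>Suc t. (if s = 0 then 0 else ?g (s - 1) n) * f (Suc t - s)) = (\<Sum>s\<le>t. ?g s n * f (t - s))"
      by (subst sum.atMost_Suc_shift) simp
    have "(\<Sum>s\<le>Suc (Suc t). ?g s n * f (Suc (Suc t) - s)) = (\<Sum>s\<le>Suc t. ?g (Suc s) n * f (Suc t - s))"
      using False by (subst sum.atMost_Suc_shift) simp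
    also have "\<dots> = (\<Sum>s\<le>Suc t. ?g s (n + 1) * f (Suc t - s) + ?g s (n - 1) * f (Suc t - s)
        - (if s = 0 then 0 else ?g (s - 1) n) * f (Suc t - s) - b n * (?g s n * f (Suc t - s)))"
      unfolding g by (intro sum.cong) (auto simp: algebra_simps)
    also have "\<dots> = (\<Sum>s\<le>Suc t. ?g s (n + 1) * f (Suc t - s)) + (\<Sum>s\<le>Suc t. ?g s (n - 1) * f (Suc t - s))
        - (\<Sum>s\<le>t. ?g s n * f (t - s)) - b n * (\<Sum>s\<le>Suc t. ?g s n * f (Suc t - s))"
      unfolding z[symmetric] sum_distrib_left sum.distrib[symmetric] sum_subtractf[symmetric] ..
    also have "\<dots> = sol b f (Suc (Suc t)) n"
      using 3 False by simp
    finally show ?thesis by simp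
  qed
qed

lemma response_kernel_iff: "response_kernel b r \<longleftrightarrow> (\<forall>s. r s = sol b delta (Suc s) 1)"
proof
  assume r: "response_kernel b r"
  show "\<forall>s. r s = sol b delta (Suc s) 1"
  proof
    fix s
    have "(\<Sum>k=0..s. r k * delta (s - k)) = (\<Sum>k\<in>{s}. r k * delta (s - k))"
      by (rule sum.mono_neutral_right) (auto simp: delta_def)
    then have "(\<Sum>k=0..s. r k * delta (s - k)) = r s" by (simp add: delta_def)
    moreover obtain u where u: "dyn_solution b delta u" using dyn_solution_exists by blast
    moreover have "u 1 (int (Suc s)) = (\<Sum>k=0..Suc s-1. r k * delta (Suc s - 1 - k))"
      using r u unfolding response_kernel_def by (metis One_nat_def Suc_leI zero_less_Suc)
    moreover have "u 1 (int (Suc s)) = sol b delta (Suc s) 1" by (rule dyn_solution_unique[OF u])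
    ultimately show "r s = sol b delta (Suc s) 1" by (simp del: sol.simps of_nat_Suc)
  qed
next
  assume r: "\<forall>s. r s = sol b delta (Suc s) 1"
  show "response_kernel b r"
    unfolding response_kernel_def
  proof (intro allI impI)
    fix f u and t :: nat
    assume u: "dyn_solution b f u" and "t \<ge> 1"
    then obtain k where k: "t = Suc k" by (cases t) auto
    have "u 1 (int t) = (\<Sum>s\<le>Suc k. sol b delta s 1 * f (Suc k - s))"
      unfolding k dyn_solution_unique[OF u] by (rule sol_convolution)
    also have "\<dots> = (\<Sum>s\<le>k. r s * f (k - s))"
      by (subst sum.atMost_Suc_shift) (simp add: r[rule_format] del: sol.simps(2,3))
    finally show "u 1 (int t) = (\<Sum>s=0..t-1. r s * f (t - 1 - s))"
      by (simp add: k atLeast0AtMost)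
  qed
qed

lemma response_kernel_ex1: "\<exists>!r. response_kernel b r"
  unfolding response_kernel_iff by (rule ex1I[of _ "\<lambda>s. sol b delta (Suc s) 1"]) auto

lemma response_vector_eq: "response_vector b s = sol b delta (Suc s) 1"
  using theI'[OF response_kernel_ex1] unfolding response_vector_def response_kernel_iff by blast

lemma response_vector_0: "response_vector b 0 = 1"
  by (simp add: response_vector_eq delta_def)

lemma sol_finite_speed: "n > t \<Longrightarrow> sol b f t n = 0"
  by (induction b f t n rule: sol.induct) auto

lemma sol_local:
  assumes "\<And>n. n \<in> {1..T-1} \<Longrightarrow> b n = b' n" and "n + t \<le> 2 * T"
  shows "sol b f t n = sol b' f t n"
  using assms
proof (induction b f t n rule: sol.induct)
  case (1 b f n)
  then show ?case by simp
next
  case (2 b f n)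
  then show ?case by (cases "n = 1") auto
next
  case (3 b f t n)
  show ?case
  proof (cases "n = 0")
    case False
    have "b n * sol b f (Suc t) n = b' n * sol b' f (Suc t) n"
    proof (cases "n < T")
      case True
      then show ?thesis using 3 False by simp
    next
      case False
      then have "n > Suc t" using "3.prems" by simp
      then show ?thesis by (simp add: sol_finite_speed del: sol.simps)
    qed
    then show ?thesis using 3 False by simp
  qed simp
qed

lemma response_vector_local:
  assumes "\<And>n. n \<in> {1..T-1} \<Longrightarrow> b n = b' n" and "s < 2 * T - 1"
  shows "response_vector b s = response_vector b' s"
  unfolding response_vector_eq by (rule sol_local[of T]) (use assms in auto)

end

theory Submission
  imports Defs
begin

text \<open>
  Write \<open>g\<^sub>t\<close> for the state at time \<open>t\<close> driven by the impulse control \<open>delta\<close>, so that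
  \<open>r\<^sub>s = g\<^bsub>s+1\<^esub> 1\<close>, and let \<open>W\<close> be the matrix with columns \<open>g\<^sub>l, \<dots>, g\<^sub>1\<close> restricted to the
  sites \<open>l, \<dots>, 1\<close>. Everything rests on two facts.

  Necessity: the inner products \<open>(g\<^sub>s, g\<^sub>t)\<close> satisfy the discrete wave equation in \<open>(s, t)\<close>,
  because the potential and the second difference in \<open>n\<close> are symmetric. Solving that equation
  from the boundary data \<open>(g\<^sub>1, g\<^sub>t) = r\<^bsub>t-1\<^esub>\<close> gives exactly the entries of \<open>C\<^sup>l\<close>
  (\<open>state_inner_eq\<close>), that is \<open>C\<^sup>l = W\<^sup>T W\<close> (\<open>kernel_mat_factorization\<close>). Since signals travel
  with speed one and the front has height one, \<open>W\<close> is triangular with unit diagonal. Hence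
  \<open>C\<^sup>l\<close> is positive definite of determinant one.

  Sufficiency: the potential is recovered site by site. Suppose \<open>b\<^sub>1, \<dots>, b\<^bsub>T-1\<^esub>\<close> reproduces
  \<open>r\<^sub>0, \<dots>, r\<^bsub>2T-2\<^esub>\<close>. The value \<open>b\<^sub>T\<close> enters the next component only as the summand \<open>-b\<^sub>T\<close>
  (\<open>front_perturbation\<close>), so one choice of \<open>b\<^sub>T\<close> produces \<open>r\<^bsub>2T-1\<^esub>\<close>. The component after that,
  \<open>r\<^bsub>2T\<^esub>\<close>, occurs in \<open>C\<^bsup>T+1\<^esup>\<close> only in the top left entry, whose cofactor is
  \<open>det C\<^sup>T = 1\<close>; therefore \<open>det C\<^bsup>T+1\<^esup> = 1\<close> determines it from the others. By necessity the
  system with potential \<open>b\<close> satisfies the same determinant condition, so the two values agree.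
\<close>

section \<open>Inner products of impulse states\<close>

definition state_inner :: "(nat \<Rightarrow> real) \<Rightarrow> nat \<Rightarrow> nat \<Rightarrow> real" where
  "state_inner b s t = (\<Sum>n=1..s. sol b delta s n * sol b delta t n)"

text \<open>
  By finite speed the sum over sites may be extended arbitrarily far, so the bound \<open>s\<close> in
  \<open>state_inner\<close> stands for the sum over all \<open>n \<ge> 1\<close>.
\<close>

lemma state_inner_extend:
  assumes "s \<le> N"
  shows "state_inner b s t = (\<Sum>n=1..N. sol b delta s n * sol b delta t n)"
  unfolding state_inner_def
  by (rule sum.mono_neutral_left) (use assms in \<open>auto simp: sol_finite_speed\<close>)

lemma sol_delta_diagonal: "sol b delta t t = 1"
proof (induction t)
  case 0
  then show ?case by (simp add: delta_def)
next
  case (Suc t)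
  then show ?case by (cases t) (auto simp: sol_finite_speed delta_def)
qed

text \<open>
  Summation by parts: the potential terms cancel in the difference of the two sides, and what
  remains is a telescoping sum whose end terms vanish, at infinity by finite speed and at the
  origin because \<open>delta\<close> is switched off at positive times.
\<close>

lemma state_inner_wave_equation:
  fixes s t :: nat
  shows "state_inner b (s + 2) (t + 1) + state_inner b s (t + 1) =
    state_inner b (s + 1) (t + 2) + state_inner b (s + 1) t"
proof -
  let ?g = "sol b delta"
  define N where "N = s + t + 2"
  \<comment> \<open>the boundary terms of the summation by parts\<close>
  let ?p = "\<lambda>n. ?g (s + 1) (n - 1) * ?g (t + 1) n"
  let ?q = "\<lambda>n. ?g (t + 1) (n - 1) * ?g (s + 1) n"
  have step: "?g (m + 2) n + ?g m n =
      ?g (m + 1) (n + 1) + ?g (m + 1) (n - 1) - b n * ?g (m + 1) n" if "n \<ge> 1" for m n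
    using that by simp
  have tele: "(\<Sum>n=1..N. ?p (Suc n) - ?p n) = 0" "(\<Sum>n=1..N. ?q (Suc n) - ?q n) = 0"
    by (subst sum_Suc_diff; simp add: N_def sol_finite_speed sol_boundary delta_def del: sol.simps)+
  have "?g (s + 2) n * ?g (t + 1) n + ?g s n * ?g (t + 1) n
      - (?g (s + 1) n * ?g (t + 2) n + ?g (s + 1) n * ?g t n)
      = (?q (Suc n) - ?q n) - (?p (Suc n) - ?p n)" if "n \<in> {1..N}" for n
  proof -
    have "?g (s + 2) n * ?g (t + 1) n + ?g s n * ?g (t + 1) n
      - (?g (s + 1) n * ?g (t + 2) n + ?g (s + 1) n * ?g t n)
      = (?g (s + 2) n + ?g s n) * ?g (t + 1) n - ?g (s + 1) n * (?g (t + 2) n + ?g t n)"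
      by (simp add: algebra_simps del: sol.simps)
    also have "\<dots> = (?q (Suc n) - ?q n) - (?p (Suc n) - ?p n)"
      using that by (simp only: step atLeastAtMost_iff) (simp add: algebra_simps del: sol.simps)
    finally show ?thesis .
  qed
  then have "(\<Sum>n=1..N. ?g (s + 2) n * ?g (t + 1) n + ?g s n * ?g (t + 1) n
      - (?g (s + 1) n * ?g (t + 2) n + ?g (s + 1) n * ?g t n))
      = (\<Sum>n=1..N. (?q (Suc n) - ?q n) - (?p (Suc n) - ?p n))"
    by (rule sum.cong[OF refl])
  also have "\<dots> = 0"
    using tele by (simp only: sum_subtractf diff_self)
  finally have "(\<Sum>n=1..N. ?g (s + 2) n * ?g (t + 1) n) + (\<Sum>n=1..N. ?g s n * ?g (t + 1) n)
      = (\<Sum>n=1..N. ?g (s + 1) n * ?g (t + 2) n) + (\<Sum>n=1..N. ?g (s + 1) n * ?g t n)"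
    by (simp only: sum_subtractf sum.distrib diff_eq_eq add_0_left)
  then show ?thesis
    by (simp add: state_inner_extend[of _ N] N_def del: sol.simps)
qed

text \<open>
  The right-hand side solves the same wave equation with the same data at \<open>s = 0\<close> and \<open>s = 1\<close>.
  The value at \<open>(s + 2, t)\<close> is computed from those at \<open>(s + 1, t + 1)\<close>, \<open>(s + 1, t - 1)\<close> and
  \<open>(s, t)\<close>; all three stay in the region where the first argument is at most the second.
\<close>

lemma state_inner_eq:
  assumes "s \<le> t"
  shows "state_inner b s t = (\<Sum>k<s. response_vector b (t - s + 2 * k))"
  using assms
proof (induction s arbitrary: t rule: less_induct)
  case (less s)
  consider "s = 0" | "s = 1" | m where "s = m + 2"
    by (metis One_nat_def add_2_eq_Suc' not0_implies_Suc)
  then show ?case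
  proof cases
    case 1
    then show ?thesis by (simp add: state_inner_def)
  next
    case 2
    then obtain k where "t = Suc k" using less.prems by (cases t) auto
    then show ?thesis using 2 sol_delta_diagonal[of b 1]
      by (simp add: state_inner_def response_vector_eq del: sol.simps)
  next
    case 3
    then obtain d where d: "t = m + d + 2" using less.prems by (metis add.assoc add.commute le_iff_add)
    let ?r = "response_vector b"
    have "state_inner b (m + 2) (m + d + 1 + 1) =
        state_inner b (m + 1) (m + d + 1 + 2) + state_inner b (m + 1) (m + d + 1) - state_inner b m (m + d + 1 + 1)"
      using state_inner_wave_equation[of b m "m + d + 1"] by simp
    also have "state_inner b (m + 1) (m + d + 1 + 2) = (\<Sum>k<m + 1. ?r (d + 2 + 2 * k))"
      by (subst less.IH) (auto simp: 3)
    also have "state_inner b (m + 1) (m + d + 1) = (\<Sum>k<m + 1. ?r (d + 2 * k))"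
      by (subst less.IH) (auto simp: 3)
    also have "state_inner b m (m + d + 1 + 1) = (\<Sum>k<m. ?r (d + 2 + 2 * k))"
      by (subst less.IH) (auto simp: 3)
    finally show ?thesis by (simp add: 3 d algebra_simps)
  qed
qed

section \<open>Factorization of the kernel matrix\<close>

text \<open>
  The matrix \<open>C\<^sup>l\<close> for a kernel given as a sequence: it makes matrices of different lengths and
  of different systems comparable without tracking dimensions of vectors.
\<close>

definition kernel_mat :: "(nat \<Rightarrow> real) \<Rightarrow> nat \<Rightarrow> real mat" where
  "kernel_mat r l = mat l l (\<lambda>(i, j).
     \<Sum>k=0..l - max (i + 1) (j + 1). r (nat \<bar>int i - int j\<bar> + 2 * k))"

lemma C_mat_eq_kernel_mat: "C_mat r l = kernel_mat (($) r) l"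
  by (simp add: C_mat_def kernel_mat_def)

lemma kernel_mat_carrier [simp]: "kernel_mat r l \<in> carrier_mat l l"
  by (simp add: kernel_mat_def)

lemma kernel_mat_cong:
  assumes "\<And>s. s < 2 * l - 1 \<Longrightarrow> r s = r' s"
  shows "kernel_mat r l = kernel_mat r' l"
  unfolding kernel_mat_def
proof (rule cong_mat[OF refl refl], clarsimp, rule sum.cong[OF refl])
  fix i j k
  assume "i < l" "j < l" "k \<in> {0..l - Suc (max i j)}"
  then have "nat \<bar>int i - int j\<bar> + 2 * k < 2 * l - 1"
    by auto
  then show "r (nat \<bar>int i - int j\<bar> + 2 * k) = r' (nat \<bar>int i - int j\<bar> + 2 * k)"
    by (rule assms)
qed

text \<open>
  Rows are the sites \<open>l, \<dots>, 1\<close> and columns the times \<open>l, \<dots>, 1\<close>: in this decreasing order the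
  indices match those of \<open>C\<^sup>l\<close>, whose smaller members are its lower right blocks.
\<close>

definition state_mat :: "(nat \<Rightarrow> real) \<Rightarrow> nat \<Rightarrow> real mat" where
  "state_mat b l = mat l l (\<lambda>(a, j). sol b delta (l - j) (l - a))"

lemma state_mat_carrier [simp]: "state_mat b l \<in> carrier_mat l l"
  by (simp add: state_mat_def)

lemma det_state_mat: "det (state_mat b l) = 1"
proof -
  have "det (state_mat b l) = prod_list (diag_mat (state_mat b l))"
    by (rule det_lower_triangular[of l]) (auto simp: state_mat_def sol_finite_speed)
  also have "\<dots> = 1"
    by (simp add: prod_list_diag_prod state_mat_def sol_delta_diagonal del: sol.simps)
  finally show ?thesis .
qed

text \<open>
  The \<open>(i, j)\<close> entry of the product is the inner product of the states at times \<open>l - i\<close> and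
  \<open>l - j\<close>; no site is lost by the restriction to \<open>n \<le> l\<close>, as no state has moved further.
\<close>

lemma kernel_mat_factorization:
  "kernel_mat (response_vector b) l = transpose_mat (state_mat b l) * state_mat b l"
proof (rule eq_matI)
  fix i j
  assume "i < dim_row (transpose_mat (state_mat b l) * state_mat b l)"
    and "j < dim_col (transpose_mat (state_mat b l) * state_mat b l)"
  then have i: "i < l" and j: "j < l" by (auto simp: state_mat_def)
  let ?g = "sol b delta"
  have flip: "(\<Sum>a<l. ?g (l - i) (l - a) * ?g (l - j) (l - a)) = (\<Sum>n=1..l. ?g (l - i) n * ?g (l - j) n)"
    by (rule sum.reindex_bij_witness[of _ "\<lambda>n. l - n" "\<lambda>a. l - a"]) auto
  have "(transpose_mat (state_mat b l) * state_mat b l) $$ (i, j)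
      = (\<Sum>n=1..l. ?g (l - i) n * ?g (l - j) n)"
    using i j flip by (simp add: state_mat_def scalar_prod_def atLeast0LessThan del: sol.simps)
  also have "\<dots> = state_inner b (min (l - i) (l - j)) (max (l - i) (l - j))"
    by (subst state_inner_extend[of _ l])
      (auto simp: min_def max_def mult.commute simp del: sol.simps)
  also have "\<dots> = (\<Sum>k<min (l - i) (l - j).
      response_vector b (max (l - i) (l - j) - min (l - i) (l - j) + 2 * k))"
    by (rule state_inner_eq) simp
  also have "max (l - i) (l - j) - min (l - i) (l - j) = nat \<bar>int i - int j\<bar>"
    using i j by (auto simp: min_def max_def)
  also have "{..<min (l - i) (l - j)} = {0..l - max (i + 1) (j + 1)}"
    using i j by auto
  finally show "kernel_mat (response_vector b) l $$ (i, j) =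
      (transpose_mat (state_mat b l) * state_mat b l) $$ (i, j)"
    using i j by (simp add: kernel_mat_def)
qed (auto simp: kernel_mat_def state_mat_def)

lemma det_kernel_mat_response: "det (kernel_mat (response_vector b) l) = 1"
  by (simp add: kernel_mat_factorization det_mult[of _ l] det_transpose[of _ l] det_state_mat)

lemma scalar_prod_self_pos:
  fixes v :: "real vec"
  assumes "v \<in> carrier_vec n" "v \<noteq> 0\<^sub>v n"
  shows "v \<bullet> v > 0"
proof -
  obtain i where "i < n" "v $ i \<noteq> 0"
    using assms by (metis carrier_vecD eq_vecI index_zero_vec(1,2))
  then show ?thesis
    unfolding scalar_prod_def using assms(1)
    by (intro sum_pos2[of _ i]) (auto simp: zero_less_mult_iff)
qed

lemma positive_definite_transpose_mult_self:
  assumes A: "A \<in> carrier_mat n n" and "det A \<noteq> 0"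
  shows "positive_definite (transpose_mat A * A)"
proof -
  have "v \<bullet> ((transpose_mat A * A) *\<^sub>v v) > 0" if v: "v \<in> carrier_vec n" "v \<noteq> 0\<^sub>v n" for v
  proof -
    have "(transpose_mat A * A) *\<^sub>v v = transpose_mat A *\<^sub>v (A *\<^sub>v v)"
      by (rule assoc_mult_mat_vec) (use A v in auto)
    then have "v \<bullet> ((transpose_mat A * A) *\<^sub>v v) = (A *\<^sub>v v) \<bullet> (A *\<^sub>v v)"
      using A v transpose_vec_mult_scalar[OF A v(1), of "A *\<^sub>v v"]
      by (metis comm_scalar_prod mult_mat_vec_carrier transpose_carrier_mat)
    moreover have "A *\<^sub>v v \<noteq> 0\<^sub>v n"
      using det_0_iff_vec_prod_zero[OF A] assms(2) v by blast
    ultimately show ?thesis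
      using scalar_prod_self_pos[of "A *\<^sub>v v" n] mult_mat_vec_carrier[OF A v(1)] by simp
  qed
  moreover have "transpose_mat (transpose_mat A * A) = transpose_mat A * A"
    using A by (simp add: transpose_mult[of _ n n])
  ultimately show ?thesis
    using A by (auto simp: positive_definite_def square_mat.simps)
qed

section \<open>Recovering the potential\<close>

text \<open>
  The front reaches site \<open>T\<close> with height one at time \<open>T\<close>, so \<open>b T\<close> first shows at time
  \<open>T + 1\<close>, where it enters the state as the summand \<open>-b T\<close>. This contribution then travels back
  unattenuated along the characteristic \<open>n + t = 2T + 1\<close>, since all other terms of the recursion
  lie on \<open>n + t \<le> 2T\<close>, where the two systems still agree.
\<close>

lemma front_perturbation:
  assumes agree: "\<And>n. n \<in> {1..T-1} \<Longrightarrow> b n = b' n"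
    and "1 \<le> n" "n \<le> T" "n + t = 2 * T + 1"
  shows "sol b delta t n - sol b' delta t n = b' T - b T"
  using assms(2-4)
proof (induction "T - n" arbitrary: n t)
  case 0
  define m where "m = t - 2"
  then have m: "t = Suc (Suc m)" "n = T" "T = Suc m"
    using 0 by linarith+
  then have "sol b delta m T = 0" "sol b' delta m T = 0"
    "sol b delta (Suc m) (T + 1) = 0" "sol b' delta (Suc m) (T + 1) = 0"
    "sol b delta (Suc m) T = 1" "sol b' delta (Suc m) T = 1"
    by (auto simp: sol_finite_speed sol_delta_diagonal simp del: sol.simps)
  moreover have "sol b delta (Suc m) (T - 1) = sol b' delta (Suc m) (T - 1)"
    by (rule sol_local[of T]) (use agree m in auto)
  ultimately show ?case using m by simp
next
  case (Suc d)
  define m where "m = t - 2"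
  then have m: "t = Suc (Suc m)"
    using Suc.prems by linarith
  have "sol b delta (Suc m) (n + 1) - sol b' delta (Suc m) (n + 1) = b' T - b T"
    by (rule Suc.hyps(1)) (use Suc m in auto)
  moreover have "sol b delta (Suc m) (n - 1) = sol b' delta (Suc m) (n - 1)"
    "sol b delta m n = sol b' delta m n" "sol b delta (Suc m) n = sol b' delta (Suc m) n"
    by (rule sol_local[of T]; use agree m Suc in auto)+
  moreover have "b n = b' n" by (rule agree) (use Suc in auto)
  ultimately show ?case using m Suc.prems by simp
qed

lemma response_vector_perturbation:
  assumes "\<And>n. n \<in> {1..T-1} \<Longrightarrow> b n = b' n" and "T \<ge> 1"
  shows "response_vector b (2 * T - 1) - response_vector b' (2 * T - 1) = b' T - b T"
  unfolding response_vector_eq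
  by (rule front_perturbation) (use assms in auto)

lemma det_diff_corner:
  fixes A B :: "'a :: comm_ring_1 mat"
  assumes A: "A \<in> carrier_mat (Suc n) (Suc n)" and B: "B \<in> carrier_mat (Suc n) (Suc n)"
    and eq: "\<And>i j. i < Suc n \<Longrightarrow> j < Suc n \<Longrightarrow> (i, j) \<noteq> (0, 0) \<Longrightarrow> A $$ (i, j) = B $$ (i, j)"
  shows "det A - det B = (A $$ (0, 0) - B $$ (0, 0)) * det (mat_delete A 0 0)"
proof -
  have cof: "cofactor A 0 j = cofactor B 0 j" if "j < Suc n" for j
  proof -
    have "mat_delete A 0 j = mat_delete B 0 j"
      using A B that by (intro eq_matI) (auto simp: mat_delete_def eq)
    then show ?thesis by (simp add: cofactor_def)
  qed
  have "det A - det B = (\<Sum>j<Suc n. (A $$ (0, j) - B $$ (0, j)) * cofactor A 0 j)"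
    by (simp only: laplace_expansion_row[OF A zero_less_Suc] laplace_expansion_row[OF B zero_less_Suc]
        sum_subtractf[symmetric] left_diff_distrib)
      (auto intro!: sum.cong simp: cof simp del: sum.lessThan_Suc)
  also have "\<dots> = (\<Sum>j\<in>{0}. (A $$ (0, j) - B $$ (0, j)) * cofactor A 0 j)"
    by (rule sum.mono_neutral_right) (auto simp: eq)
  finally show ?thesis by (simp add: cofactor_def)
qed

lemma mat_delete_kernel_mat: "mat_delete (kernel_mat r (Suc l)) 0 0 = kernel_mat r l"
  by (rule eq_matI) (auto simp: mat_delete_def kernel_mat_def)

lemma kernel_mat_corner: "kernel_mat r (Suc l) $$ (0, 0) = (\<Sum>k\<le>l. r (2 * k))"
  by (simp add: kernel_mat_def atLeast0AtMost)

text \<open>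
  Of the components occurring in \<open>C\<^bsup>l+1\<^esup>\<close>, the last one, \<open>r\<^bsub>2l\<^esub>\<close>, sits only in the top left
  entry; the cofactor of that entry is \<open>det C\<^sup>l\<close>.
\<close>

lemma kernel_mat_det_determines_last:
  assumes agree: "\<And>s. s < 2 * l \<Longrightarrow> r s = r' s"
    and det_eq: "det (kernel_mat r (Suc l)) = det (kernel_mat r' (Suc l))"
    and det_nz: "det (kernel_mat r l) \<noteq> 0"
  shows "r (2 * l) = r' (2 * l)"
proof -
  have off_corner: "kernel_mat r (Suc l) $$ (i, j) = kernel_mat r' (Suc l) $$ (i, j)"
    if "i < Suc l" "j < Suc l" "(i, j) \<noteq> (0, 0)" for i j
  proof -
    have "nat \<bar>int i - int j\<bar> + 2 * k < 2 * l" if "k \<in> {0..Suc l - max (i + 1) (j + 1)}" for k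
      using that \<open>i < Suc l\<close> \<open>j < Suc l\<close> \<open>(i, j) \<noteq> (0, 0)\<close> by auto
    then show ?thesis
      using that by (simp add: kernel_mat_def agree)
  qed
  have "det (kernel_mat r (Suc l)) - det (kernel_mat r' (Suc l)) =
      (kernel_mat r (Suc l) $$ (0, 0) - kernel_mat r' (Suc l) $$ (0, 0)) * det (kernel_mat r l)"
    using det_diff_corner[OF kernel_mat_carrier kernel_mat_carrier off_corner]
    by (simp add: mat_delete_kernel_mat)
  then have "kernel_mat r (Suc l) $$ (0, 0) = kernel_mat r' (Suc l) $$ (0, 0)"
    using det_eq det_nz by simp
  then have "(\<Sum>k<l. r (2 * k)) + r (2 * l) = (\<Sum>k<l. r' (2 * k)) + r' (2 * l)"
    by (simp add: kernel_mat_corner flip: lessThan_Suc_atMost)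
  moreover have "(\<Sum>k<l. r (2 * k)) = (\<Sum>k<l. r' (2 * k))"
    by (rule sum.cong) (auto simp: agree)
  ultimately show ?thesis by simp
qed

text \<open>
  Each induction step extends the potential by one site and the matched part of the kernel by two
  components: the new potential value is fitted to the odd one, and the even one follows from the
  determinant condition, which the system with the new potential satisfies as well.
\<close>

lemma potential_from_dets:
  assumes "r 0 = 1" and "\<And>l. l \<in> {1..Suc L} \<Longrightarrow> det (kernel_mat r l) = 1"
  shows "\<exists>b. \<forall>s\<le>2 * L. r s = response_vector b s"
  using assms(2)
proof (induction L)
  case 0
  then show ?case using assms(1) by (auto simp: response_vector_0)
next
  case (Suc L)
  have "\<exists>b. \<forall>s\<le>2 * L. r s = response_vector b s"
    by (rule Suc.IH) (use Suc.prems in auto)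
  then obtain b where b: "\<And>s. s \<le> 2 * L \<Longrightarrow> r s = response_vector b s" by blast
  \<comment> \<open>the new value at site \<open>Suc L\<close> corrects the error of \<open>b\<close> in component \<open>2 * L + 1\<close>\<close>
  define b' where
    "b' = b(Suc L := b (Suc L) + response_vector b (2 * L + 1) - r (2 * L + 1))"
  have old: "r s = response_vector b' s" if "s \<le> 2 * L" for s
    using that b[OF that] response_vector_local[of "Suc L" b b' s] by (simp add: b'_def)
  have "response_vector b (2 * Suc L - 1) - response_vector b' (2 * Suc L - 1)
      = b' (Suc L) - b (Suc L)"
    by (rule response_vector_perturbation) (auto simp: b'_def)
  then have odd: "r (2 * L + 1) = response_vector b' (2 * L + 1)"
    by (simp add: b'_def)
  have agree: "r s = response_vector b' s" if "s < 2 * Suc L" for s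
    using that old odd by (cases "s = 2 * L + 1") auto
  have "r (2 * Suc L) = response_vector b' (2 * Suc L)"
    by (rule kernel_mat_det_determines_last[OF agree])
      (use Suc.prems in \<open>auto simp: det_kernel_mat_response\<close>)
  then have "\<forall>s\<le>2 * Suc L. r s = response_vector b' s"
    using agree by (metis le_neq_implies_less)
  then show ?case by blast
qed

text \<open>
  The values of a potential beyond site \<open>T - 1\<close> do not reach the first \<open>2T - 1\<close> components.
\<close>

lemma ex_is_response_vector_for_iff:
  assumes "dim_vec r = 2 * T - 1"
  shows "(\<exists>p. is_response_vector_for T p r) \<longleftrightarrow>
    (\<exists>b. \<forall>s<2 * T - 1. r $ s = response_vector b s)"
proof
  assume "\<exists>p. is_response_vector_for T p r"
  then obtain p where "is_response_vector_for T p r" ..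
  then have "\<forall>s<2 * T - 1. r $ s = response_vector (\<lambda>n. p $ (n - 1)) s"
    by (simp add: is_response_vector_for_def)
  then show "\<exists>b. \<forall>s<2 * T - 1. r $ s = response_vector b s" by blast
next
  assume "\<exists>b. \<forall>s<2 * T - 1. r $ s = response_vector b s"
  then obtain b where b: "\<And>s. s < 2 * T - 1 \<Longrightarrow> r $ s = response_vector b s" by blast
  have "r $ s = response_vector b' s"
    if "\<forall>n\<in>{1..T-1}. b' n = vec (T - 1) (\<lambda>i. b (i + 1)) $ (n - 1)" "s < 2 * T - 1" for b' s
  proof -
    have "b n = b' n" if "n \<in> {1..T-1}" for n
      using that \<open>\<forall>n\<in>{1..T-1}. b' n = vec (T - 1) (\<lambda>i. b (i + 1)) $ (n - 1)\<close> by auto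
    then show ?thesis
      using b[OF that(2)] response_vector_local[of T b b' s, OF _ that(2)] by simp
  qed
  then have "is_response_vector_for T (vec (T - 1) (\<lambda>i. b (i + 1))) r"
    unfolding is_response_vector_for_def using assms by simp
  then show "\<exists>p. is_response_vector_for T p r" ..
qed

theorem theorem5:
  fixes T :: nat and r :: "real vec"
  assumes "T \<ge> 1"
    and "dim_vec r = 2 * T - 1"
    and "r $ 0 = 1"
  shows "(\<exists>p. is_response_vector_for T p r) \<longleftrightarrow>
         positive_definite (C_mat r T) \<and> (\<forall>l\<in>{1..T}. det (C_mat r l) = 1)"
  unfolding ex_is_response_vector_for_iff[OF assms(2)] C_mat_eq_kernel_mat
proof
  assume "\<exists>b. \<forall>s<2 * T - 1. r $ s = response_vector b s"
  then obtain b where b: "\<And>s. s < 2 * T - 1 \<Longrightarrow> r $ s = response_vector b s" by blast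
  have C: "kernel_mat (($) r) l = kernel_mat (response_vector b) l" if "l \<le> T" for l
    by (rule kernel_mat_cong) (use b that in auto)
  show "positive_definite (kernel_mat (($) r) T) \<and> (\<forall>l\<in>{1..T}. det (kernel_mat (($) r) l) = 1)"
    using positive_definite_transpose_mult_self[OF state_mat_carrier, of b T]
    by (simp add: C det_kernel_mat_response det_state_mat flip: kernel_mat_factorization)
next
  assume "positive_definite (kernel_mat (($) r) T) \<and> (\<forall>l\<in>{1..T}. det (kernel_mat (($) r) l) = 1)"
  then have "\<exists>b. \<forall>s\<le>2 * (T - 1). r $ s = response_vector b s"
    using assms by (intro potential_from_dets) auto
  moreover have "s \<le> 2 * (T - 1)" if "s < 2 * T - 1" for s
    using that by linarith
  ultimately show "\<exists>b. \<forall>s<2 * T - 1. r $ s = response_vector b s"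
    by blast
qed

end
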